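(* Let $R$ be a commutative ring with identity in which the positive integer multiples of $1_R$ are not zero divisors, and let $N\ge 2$. For every $c \in R$, the only harmonic polynomial in $R[X_1,\ldots,X_N]$ that is a multiple of $X_1^2+\cdots+X_N^2 - c$ in $R[X_1,\ldots,X_N]$ is $0$.
   Context: A polynomial $p\in R[X_1,\ldots,X_N]$ is harmonic if $\Delta_N p = 0$, where $\Delta_N = \partial_1^2+\cdots+\partial_N^2$ and $\partial_j=\partial/\partial X_j$. An element $a\in R$ is "not a zero divisor" if $ab=0$ with $b\in R$ implies $b=0$. *)

theory Defs
  imports Main "HOL-Library.Poly_Mapping" "HOL-Library.Cardinality"
begin

text \<open>
  A commutative ring with identity is a type of sort \<open>{comm_ring, comm_monoid_mult}\<close>. The class
  \<open>comm_ring_1\<close> would in addition require \<open>0 \<noteq> 1\<close> and so exclude the zero ring. As the library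
  constants \<open>of_nat\<close>, \<open>dvd\<close> and, on polynomials, \<open>1\<close> and \<open>^\<close> depend on classes containing that
  requirement, integer multiples, squares and divisibility are written out.
\<close>

definition nat_multiple :: "nat \<Rightarrow> 'a::comm_monoid_add \<Rightarrow> 'a"
  where "nat_multiple k a = (\<Sum>i<k. a)"

definition not_zero_divisor :: "'a::comm_ring \<Rightarrow> bool"
  where "not_zero_divisor a \<longleftrightarrow> (\<forall>b. a * b = 0 \<longrightarrow> b = 0)"

text \<open>
  Polynomials over \<open>'a\<close> in variables indexed by the type \<open>'n\<close>: a finitely supported map sending
  each exponent vector \<open>'n \<Rightarrow>\<^sub>0 nat\<close> to its coefficient, with the library's convolution product.
  For \<open>'n\<close> of class \<open>finite\<close> there are \<open>N = CARD('n)\<close> variables.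
\<close>

type_synonym ('n, 'a) mpoly = "('n \<Rightarrow>\<^sub>0 nat) \<Rightarrow>\<^sub>0 'a"

definition Const :: "'a::comm_ring \<Rightarrow> ('n, 'a) mpoly"
  where "Const c = Poly_Mapping.single 0 c"

definition Var :: "'n \<Rightarrow> ('n, 'a::{comm_ring, comm_monoid_mult}) mpoly"
  where "Var j = Poly_Mapping.single (Poly_Mapping.single j 1) 1"

text \<open>
  The linear extension of \<open>a X\<^sup>m \<mapsto> (m\<^sub>j a) X\<^bsup>m - e\<^sub>j\<^esup>\<close>. If \<open>m\<^sub>j = 0\<close>, the truncated
  subtraction in the exponent is harmless, since the coefficient vanishes.
\<close>

definition partial_deriv :: "'n \<Rightarrow> ('n, 'a::comm_ring) mpoly \<Rightarrow> ('n, 'a) mpoly"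
  where "partial_deriv j p =
    (\<Sum>m\<in>Poly_Mapping.keys p.
      Poly_Mapping.single (m - Poly_Mapping.single j 1)
        (nat_multiple (Poly_Mapping.lookup m j) (Poly_Mapping.lookup p m)))"

definition laplacian :: "('n::finite, 'a::comm_ring) mpoly \<Rightarrow> ('n, 'a) mpoly"
  where "laplacian p = (\<Sum>j\<in>UNIV. partial_deriv j (partial_deriv j p))"

definition harmonic :: "('n::finite, 'a::comm_ring) mpoly \<Rightarrow> bool"
  where "harmonic p \<longleftrightarrow> laplacian p = 0"

end

theory Submission
  imports Defs
begin

text \<open>
  On coefficient functions, the Laplacian \<open>L\<close> and multiplication by \<open>X\<^sub>1\<^sup>2 + \<dots> + X\<^sub>N\<^sup>2\<close>, called \<open>R\<close>,
  satisfy \<open>L R = R L + (4 d + 2 N)\<close> in degree \<open>d\<close>. Hence \<open>R L + k\<close> is injective in every degree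
  for every integer \<open>k > 0\<close>: if it kills \<open>f\<close> in degree \<open>d\<close>, applying \<open>L\<close> shows that \<open>R L + k'\<close>
  with \<open>k' = k + 4 (d - 2) + 2 N\<close> kills \<open>L f\<close> in degree \<open>d - 2\<close>, so \<open>L f = 0\<close> there by induction
  and \<open>k f = 0\<close>. If \<open>p = (X\<^sub>1\<^sup>2 + \<dots> + X\<^sub>N\<^sup>2 - c) q\<close> is harmonic and \<open>q\<close> has degree \<open>d\<close>, the
  degree-\<open>d\<close> part of \<open>L p = 0\<close> says that \<open>L R = R L + (4 d + 2 N)\<close> kills the leading form of \<open>q\<close>.
\<close>

section \<open>Integer multiples and degrees of exponent vectors\<close>

abbreviation unit_exp :: "'n \<Rightarrow> nat \<Rightarrow> 'n \<Rightarrow>\<^sub>0 nat"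
  where "unit_exp j k \<equiv> Poly_Mapping.single j k"

definition total_degree :: "('n::finite \<Rightarrow>\<^sub>0 nat) \<Rightarrow> nat"
  where "total_degree m = (\<Sum>j\<in>UNIV. Poly_Mapping.lookup m j)"

abbreviation nat_elem :: "nat \<Rightarrow> 'a::{comm_ring, comm_monoid_mult}"
  where "nat_elem k \<equiv> nat_multiple k 1"

lemma nat_multiple_0 [simp]: "nat_multiple 0 a = 0"
  by (simp add: nat_multiple_def)

lemma nat_multiple_Suc: "nat_multiple (Suc k) a = nat_multiple k a + a"
  by (simp add: nat_multiple_def)

lemma nat_multiple_zero_right [simp]: "nat_multiple k 0 = 0"
  by (simp add: nat_multiple_def)

lemma nat_multiple_conv_mult:
  fixes a :: "'a::{comm_ring, comm_monoid_mult}"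
  shows "nat_multiple k a = nat_elem k * a"
  by (simp add: nat_multiple_def sum_distrib_right)

lemma nat_multiple_add: "nat_multiple (k + l) a = nat_multiple k a + nat_multiple l a"
  by (induction l) (simp_all add: nat_multiple_Suc add.assoc)

lemma nat_elem_mult:
  "nat_elem (k * l) = (nat_elem k * nat_elem l :: 'a::{comm_ring, comm_monoid_mult})"
  by (induction l) (simp_all add: nat_multiple_Suc nat_multiple_add algebra_simps)

lemma nat_elem_sum:
  "finite A \<Longrightarrow> nat_elem (\<Sum>i\<in>A. f i) = (\<Sum>i\<in>A. nat_elem (f i) :: 'a::{comm_ring, comm_monoid_mult})"
  by (induction rule: finite_induct) (simp_all add: nat_multiple_add)

lemma total_degree_add: "total_degree (m + n) = total_degree m + total_degree n"
  by (simp add: total_degree_def lookup_add sum.distrib)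

lemma total_degree_unit_exp [simp]: "total_degree (unit_exp j k) = k"
  by (simp add: total_degree_def lookup_single when_def)

lemma minus_unit_exp_add:
  assumes "k \<le> Poly_Mapping.lookup m j"
  shows "m - unit_exp j k + unit_exp j k = m"
  using assms by (intro poly_mapping_eqI) (auto simp: lookup_add lookup_minus lookup_single when_def)

section \<open>Operators on coefficient functions\<close>

text \<open>Acting on arbitrary functions spares tracking finite support when the operators are
  composed.\<close>

definition lap_coeff :: "(('n::finite \<Rightarrow>\<^sub>0 nat) \<Rightarrow> 'a::{comm_ring, comm_monoid_mult}) \<Rightarrow> ('n \<Rightarrow>\<^sub>0 nat) \<Rightarrow> 'a"
  where "lap_coeff f m = (\<Sum>j\<in>UNIV.
    nat_elem ((Poly_Mapping.lookup m j + 1) * (Poly_Mapping.lookup m j + 2)) * f (m + unit_exp j 2))"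

text \<open>The guard matters: with an exponent below 2, truncated subtraction would read
  \<open>f\<close> at an unrelated exponent vector.\<close>

definition sq_coeff :: "(('n::finite \<Rightarrow>\<^sub>0 nat) \<Rightarrow> 'a::{comm_ring, comm_monoid_mult}) \<Rightarrow> ('n \<Rightarrow>\<^sub>0 nat) \<Rightarrow> 'a"
  where "sq_coeff f m = (\<Sum>j\<in>UNIV.
    if 2 \<le> Poly_Mapping.lookup m j then f (m - unit_exp j 2) else 0)"

lemma lookup_single_times:
  fixes q :: "('n, 'a::{comm_ring, comm_monoid_mult}) mpoly"
  shows "Poly_Mapping.lookup (Poly_Mapping.single (unit_exp j k) a * q) m =
    (if k \<le> Poly_Mapping.lookup m j then a * Poly_Mapping.lookup q (m - unit_exp j k) else 0)"
proof -
  have eq: "m = unit_exp j k + n \<longleftrightarrow> k \<le> Poly_Mapping.lookup m j \<and> n = m - unit_exp j k" for n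
    using minus_unit_exp_add[of k m j] by (auto simp: lookup_add add.commute)
  have "Poly_Mapping.lookup (Poly_Mapping.single (unit_exp j k) a * q) m =
      (\<Sum>l. (a when unit_exp j k = l) * (\<Sum>n. Poly_Mapping.lookup q n when m = l + n))"
    by (simp add: lookup_mult lookup_single)
  also have "\<dots> = a * (\<Sum>n. Poly_Mapping.lookup q n when m = unit_exp j k + n)"
    by (simp add: when_mult)
  \<comment> \<open>With the guard moved into the summand, the condition fixes \<open>n\<close> and
    the sum collapses to one term.\<close>
  also have "\<dots> = a * (\<Sum>n. (if k \<le> Poly_Mapping.lookup m j then Poly_Mapping.lookup q n else 0) when n = m - unit_exp j k)"
    unfolding eq by (intro arg_cong[where f = "(*) a"] Sum_any.cong) (auto simp: when_def)
  finally show ?thesis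
    by simp
qed

lemma lookup_partial_deriv:
  fixes p :: "('n, 'a::comm_ring) mpoly"
  shows "Poly_Mapping.lookup (partial_deriv j p) m =
    nat_multiple (Poly_Mapping.lookup m j + 1) (Poly_Mapping.lookup p (m + unit_exp j 1))"
proof -
  have "Poly_Mapping.lookup (partial_deriv j p) m = (\<Sum>n\<in>Poly_Mapping.keys p.
      nat_multiple (Poly_Mapping.lookup n j) (Poly_Mapping.lookup p n) when n - unit_exp j 1 = m)"
    by (simp add: partial_deriv_def lookup_sum lookup_single)
  also have "\<dots> = (\<Sum>n\<in>Poly_Mapping.keys p. if n = m + unit_exp j 1
      then nat_multiple (Poly_Mapping.lookup n j) (Poly_Mapping.lookup p n) else 0)"
  proof (rule sum.cong[OF refl])
    fix n
    show "(nat_multiple (Poly_Mapping.lookup n j) (Poly_Mapping.lookup p n) when n - unit_exp j 1 = m) =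
      (if n = m + unit_exp j 1
       then nat_multiple (Poly_Mapping.lookup n j) (Poly_Mapping.lookup p n) else 0)"
    \<comment> \<open>If the exponent is 0, truncation can make \<open>n - unit_exp j 1 = m\<close>
      hold with \<open>n = m\<close>, but the coefficient is then a 0-fold multiple.\<close>
    proof (cases "Poly_Mapping.lookup n j = 0")
      case False
      then have "n - unit_exp j 1 = m \<longleftrightarrow> n = m + unit_exp j 1"
        using minus_unit_exp_add[of 1 n j] by auto
      then show ?thesis
        by (simp add: when_def)
    qed (auto simp: when_def)
  qed
  also have "\<dots> = nat_multiple (Poly_Mapping.lookup m j + 1) (Poly_Mapping.lookup p (m + unit_exp j 1))"
    by (simp add: lookup_add in_keys_iff)
  finally show ?thesis .
qed

lemma lookup_laplacian:
  fixes p :: "('n::finite, 'a::{comm_ring, comm_monoid_mult}) mpoly"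
  shows "Poly_Mapping.lookup (laplacian p) m = lap_coeff (Poly_Mapping.lookup p) m"
proof -
  have "Poly_Mapping.lookup (partial_deriv j (partial_deriv j p)) m =
      nat_elem ((Poly_Mapping.lookup m j + 1) * (Poly_Mapping.lookup m j + 2)) *
        Poly_Mapping.lookup p (m + unit_exp j 2)" for j
  proof -
    let ?k = "Poly_Mapping.lookup m j"
    have "Poly_Mapping.lookup (partial_deriv j (partial_deriv j p)) m =
        nat_multiple (?k + 1) (nat_multiple (?k + 1 + 1)
          (Poly_Mapping.lookup p (m + unit_exp j 1 + unit_exp j 1)))"
      by (simp only: lookup_partial_deriv lookup_add lookup_single_eq)
    also have "m + unit_exp j 1 + unit_exp j 1 = m + unit_exp j 2"
      by (simp only: add.assoc one_add_one flip: single_add)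
    also have "?k + 1 + 1 = ?k + 2"
      by simp
    also have "nat_multiple (?k + 1) (nat_multiple (?k + 2) a) =
        nat_elem ((?k + 1) * (?k + 2)) * a" for a :: 'a
      by (subst nat_multiple_conv_mult, subst nat_multiple_conv_mult[of _ a])
        (simp only: nat_elem_mult mult.assoc)
    finally show ?thesis .
  qed
  then show ?thesis
    by (simp only: laplacian_def lap_coeff_def lookup_sum)
qed

lemma lookup_sum_Var_sq_times:
  fixes q :: "('n::finite, 'a::{comm_ring, comm_monoid_mult}) mpoly"
  shows "Poly_Mapping.lookup ((\<Sum>j\<in>UNIV. Var j * Var j) * q) m = sq_coeff (Poly_Mapping.lookup q) m"
proof -
  have "(Var j * Var j :: ('n, 'a) mpoly) = Poly_Mapping.single (unit_exp j 2) 1" for j :: 'n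
    by (simp add: Var_def mult_single numeral_2_eq_2 flip: single_add)
  then show ?thesis
    by (simp add: sum_distrib_right lookup_sum lookup_single_times sq_coeff_def cong: if_cong)
qed

lemma lookup_Const_times:
  fixes q :: "('n::finite, 'a::{comm_ring, comm_monoid_mult}) mpoly"
  shows "Poly_Mapping.lookup (Const c * q) m = c * Poly_Mapping.lookup q m"
  \<comment> \<open>The exponent 0 equals \<open>unit_exp j 0\<close> for every \<open>j\<close>, so
    any index serves.\<close>
  using lookup_single_times[of undefined 0 c q m] by (simp add: Const_def)

section \<open>Commutation relation, injectivity and the leading form\<close>

text \<open>Differentiation in one variable commutes with squaring another. For the same variable
  with exponent t, the two orders differ by (t+1)(t+2) - (t-1)t = 4t + 2; summing over the variables
  gives the factor.\<close>

lemma lap_coeff_sq_coeff: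
  fixes f :: "('n::finite \<Rightarrow>\<^sub>0 nat) \<Rightarrow> 'a::{comm_ring, comm_monoid_mult}"
  shows "lap_coeff (sq_coeff f) m =
    sq_coeff (lap_coeff f) m + nat_elem (4 * total_degree m + 2 * CARD('n)) * f m"
proof -
  let ?l = "Poly_Mapping.lookup m"
  \<comment> \<open>\<open>A i j\<close> and \<open>B i j\<close> are the contributions of
    differentiating in \<open>i\<close> and multiplying by the square of variable \<open>j\<close>,
    in the two orders.\<close>
  define A where "A i j = nat_elem ((?l i + 1) * (?l i + 2)) *
    (if 2 \<le> Poly_Mapping.lookup (m + unit_exp i 2) j then f (m + unit_exp i 2 - unit_exp j 2) else 0)" for i j
  define B where "B i j = (if 2 \<le> ?l j then
    nat_elem ((Poly_Mapping.lookup (m - unit_exp j 2) i + 1) * (Poly_Mapping.lookup (m - unit_exp j 2) i + 2))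
      * f (m - unit_exp j 2 + unit_exp i 2) else 0)" for i j
  have comm: "m + unit_exp i 2 - unit_exp j 2 = m - unit_exp j 2 + unit_exp i 2" if "i \<noteq> j" for i j
    using that by (intro poly_mapping_eqI) (auto simp: lookup_add lookup_minus lookup_single when_def)
  have AB: "A i j = B i j + (if i = j then nat_elem (4 * ?l i + 2) * f m else 0)" for i j
  proof (cases "i = j")
    case False
    then show ?thesis
      by (simp add: A_def B_def comm lookup_add lookup_minus lookup_single)
  next
    case True
    have A: "A i i = nat_elem ((?l i + 1) * (?l i + 2)) * f m"
      by (simp add: A_def lookup_add)
    \<comment> \<open>The guard disappears here, since the factor \<open>(?l i - 1) * ?l i\<close>
      vanishes for exponents 0 and 1.\<close>
    have B: "B i i = nat_elem ((?l i - 1) * ?l i) * f m"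
    proof (cases "2 \<le> ?l i")
      case True
      then have "?l i - 2 + 1 = ?l i - 1" "?l i - 2 + 2 = ?l i"
        by simp_all
      with True show ?thesis
        by (simp only: B_def lookup_minus lookup_single_eq minus_unit_exp_add if_True)
    next
      case False
      then have "?l i = 0 \<or> ?l i = 1"
        by linarith
      then show ?thesis
        by (auto simp: B_def)
    qed
    have "(?l i + 1) * (?l i + 2) = (?l i - 1) * ?l i + (4 * ?l i + 2)"
      by (cases "?l i") (simp_all add: algebra_simps)
    then have "A i i = B i i + nat_elem (4 * ?l i + 2) * f m"
      unfolding A B by (simp only: nat_multiple_add distrib_right)
    with True show ?thesis
      by simp
  qed
  have "lap_coeff (sq_coeff f) m = (\<Sum>i\<in>UNIV. \<Sum>j\<in>UNIV. A i j)"
    by (simp only: lap_coeff_def sq_coeff_def A_def sum_distrib_left)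
  also have "\<dots> = (\<Sum>i\<in>UNIV. \<Sum>j\<in>UNIV. B i j) + (\<Sum>i\<in>UNIV. nat_elem (4 * ?l i + 2) * f m)"
    by (simp add: AB sum.distrib)
  also have "(\<Sum>i\<in>UNIV. \<Sum>j\<in>UNIV. B i j) = sq_coeff (lap_coeff f) m"
    unfolding lap_coeff_def sq_coeff_def B_def
    by (subst sum.swap, intro sum.cong refl) auto
  also have "(\<Sum>i\<in>UNIV. nat_elem (4 * ?l i + 2) * f m) =
      nat_elem (4 * total_degree m + 2 * CARD('n)) * f m"
  proof -
    have "(\<Sum>i\<in>UNIV. 4 * ?l i + 2) = 4 * total_degree m + 2 * CARD('n)"
      by (subst sum.distrib) (simp add: total_degree_def sum_distrib_left)
    then show ?thesis
      by (metis (no_types, lifting) finite nat_elem_sum sum.cong sum_distrib_right)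
  qed
  finally show ?thesis .
qed

text \<open>The composite preserves degree, so each degree can be treated alone. Both
  \<open>f\<close> and \<open>k\<close> vary in the induction, which passes to
  \<open>lap_coeff f\<close> and a larger constant.\<close>

lemma sq_lap_plus_nat_injective:
  fixes f :: "('n::finite \<Rightarrow>\<^sub>0 nat) \<Rightarrow> 'a::{comm_ring, comm_monoid_mult}"
  assumes nzd: "\<And>k. k > 0 \<Longrightarrow> not_zero_divisor (nat_elem k :: 'a)"
    and "k > 0"
    and "\<And>m. total_degree m = d \<Longrightarrow> sq_coeff (lap_coeff f) m + nat_elem k * f m = 0"
    and "total_degree m = d"
  shows "f m = 0"
  using assms(2-)
proof (induction d arbitrary: f k m rule: less_induct)
  case (less d)
  have lap_zero: "lap_coeff f n = 0" if n: "total_degree n + 2 = d" for n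
  proof (rule less.IH)
    \<comment> \<open>The increment is the commutator factor in degree \<open>d - 2\<close>.\<close>
    let ?k = "k + (4 * total_degree n + 2 * CARD('n))"
    show "total_degree n < d" "0 < ?k"
      using n less.prems(1) by simp_all
    fix m :: "'n \<Rightarrow>\<^sub>0 nat"
    assume m: "total_degree m = total_degree n"
    \<comment> \<open>In degree \<open>d - 2\<close>, \<open>lap_coeff\<close> reads only values in
      degree \<open>d\<close>, where the hypothesis gives 0.\<close>
    have "0 = lap_coeff (\<lambda>m. sq_coeff (lap_coeff f) m + nat_elem k * f m) m"
      using m n by (simp add: lap_coeff_def[of "\<lambda>m. sq_coeff _ m + _ m"] less.prems(2) total_degree_add)
    also have "\<dots> = lap_coeff (sq_coeff (lap_coeff f)) m + nat_elem k * lap_coeff f m"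
      by (simp add: lap_coeff_def[of "\<lambda>m. sq_coeff _ m + _ m"] lap_coeff_def[of "sq_coeff _"]
          lap_coeff_def[of f m] sum.distrib sum_distrib_left distrib_left mult.left_commute)
    also have "\<dots> = sq_coeff (lap_coeff (lap_coeff f)) m + nat_elem ?k * lap_coeff f m"
      by (simp add: lap_coeff_sq_coeff m nat_multiple_add algebra_simps)
    finally show "sq_coeff (lap_coeff (lap_coeff f)) m + nat_elem ?k * lap_coeff f m = 0"
      by simp
  qed simp
  \<comment> \<open>Every value read by \<open>sq_coeff\<close> at \<open>m\<close> lies in degree
    \<open>d - 2\<close>; for \<open>d < 2\<close> no index passes the guard.\<close>
  have "total_degree (m - unit_exp j 2) + 2 = d" if "2 \<le> Poly_Mapping.lookup m j" for j
    using minus_unit_exp_add[OF that] less.prems(3) by (metis total_degree_add total_degree_unit_exp)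
  then have "sq_coeff (lap_coeff f) m = 0"
    unfolding sq_coeff_def by (intro sum.neutral) (auto intro: lap_zero)
  then have "nat_elem k * f m = 0"
    using less.prems by fastforce
  then show ?case
    using nzd[OF less.prems(1)] by (simp add: not_zero_divisor_def)
qed

lemma harmonic_multiple_imp_zero:
  fixes q :: "('n::finite, 'a::{comm_ring, comm_monoid_mult}) mpoly"
  assumes nzd: "\<And>k. k > 0 \<Longrightarrow> not_zero_divisor (nat_elem k :: 'a)"
    and "harmonic (((\<Sum>j\<in>UNIV. Var j * Var j) - Const c) * q)"
  shows "q = 0"
proof (rule ccontr)
  assume "q \<noteq> 0"
  let ?q = "Poly_Mapping.lookup q"
  define d where "d = Max (total_degree ` Poly_Mapping.keys q)"
  have "d \<in> total_degree ` Poly_Mapping.keys q"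
    unfolding d_def using \<open>q \<noteq> 0\<close> by (intro Max_in) auto
  then obtain m where m: "total_degree m = d" "?q m \<noteq> 0"
    by (auto simp: in_keys_iff)
  have above: "?q n = 0" if "d < total_degree n" for n
  proof (rule ccontr)
    assume "?q n \<noteq> 0"
    then have "total_degree n \<le> d"
      unfolding d_def by (intro Max_ge) (auto simp: in_keys_iff)
    with that show False
      by simp
  qed
  have "?q m = 0"
  proof (rule sq_lap_plus_nat_injective[OF nzd])
    show "0 < 4 * d + 2 * CARD('n)"
      by simp
    fix n :: "'n \<Rightarrow>\<^sub>0 nat"
    assume n: "total_degree n = d"
    have "Poly_Mapping.lookup (((\<Sum>j\<in>UNIV. Var j * Var j) - Const c) * q) =
        (\<lambda>n. sq_coeff ?q n - c * ?q n)"
      by (simp add: fun_eq_iff left_diff_distrib lookup_minus lookup_sum_Var_sq_times lookup_Const_times)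
    then have "0 = lap_coeff (\<lambda>n. sq_coeff ?q n - c * ?q n) n"
      using assms(2) lookup_laplacian[of "((\<Sum>j\<in>UNIV. Var j * Var j) - Const c) * q" n]
      by (simp add: harmonic_def)
    \<comment> \<open>The term with \<open>c\<close> drops out: \<open>lap_coeff\<close> reads it in
      degree \<open>d + 2\<close>, above the degree of \<open>q\<close>.\<close>
    also have "\<dots> = lap_coeff (sq_coeff ?q) n"
      using n by (simp add: lap_coeff_def above total_degree_add)
    finally show "sq_coeff (lap_coeff ?q) n + nat_elem (4 * d + 2 * CARD('n)) * ?q n = 0"
      by (simp add: lap_coeff_sq_coeff n)
  qed (use m in simp_all)
  with m show False
    by simp
qed

text \<open>The equivalence also records that 0 itself is a harmonic multiple.\<close>

theorem proposition2p8:
  fixes c :: "'a::{comm_ring, comm_monoid_mult}"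
    and p :: "('n::finite, 'a) mpoly"
  assumes "\<And>k. k > 0 \<Longrightarrow> not_zero_divisor (nat_multiple k (1::'a))"
    and "CARD('n) \<ge> 2"
  shows "harmonic p \<and> (\<exists>q. p = ((\<Sum>j\<in>UNIV. Var j * Var j) - Const c) * q) \<longleftrightarrow> p = 0"
proof
  assume "harmonic p \<and> (\<exists>q. p = ((\<Sum>j\<in>UNIV. Var j * Var j) - Const c) * q)"
  then show "p = 0"
    using harmonic_multiple_imp_zero[OF assms(1), of c] by force
next
  assume "p = 0"
  then show "harmonic p \<and> (\<exists>q. p = ((\<Sum>j\<in>UNIV. Var j * Var j) - Const c) * q)"
    by (auto simp: harmonic_def laplacian_def partial_deriv_def intro: exI[of _ 0])
qed

end
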